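(* Let $G$ be a connected TB graph of odd order $n=2p+1$ with $p\geq 1$. Then $RE(G)\leq RE(S^p)$, where $S^p$ is the $p$-sun (which has the same order $n$).
   Context: Graphs are finite, simple and undirected. For a graph $G$ with vertex set $V$, edge set $E$ and vertex degrees $d_u$, the Randić matrix $R=[r_{uv}]$ is the real symmetric matrix indexed by $V$ with $r_{uv}=1/\sqrt{d_ud_v}$ if $uv\in E$ and $r_{uv}=0$ otherwise. The Randić energy is $RE(G)=\sum_{i=1}^n|\lambda_i|$, where $\lambda_1,\dots,\lambda_n$ are the eigenvalues of $R$ with multiplicity. A TB graph is a bipartite graph with a bipartition $V=A\cup B$ such that $\deg(b)\leq 2$ for every $b\in B$. The $p$-sun $S^p$ is the tree of order $2p+1$ obtained from the star on $p+1$ vertices (one center joined to $p$ leaves) by subdividing each edge once. *)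

theory Defs
  imports Graph_Theory.Graph_Theory Jordan_Normal_Form.Char_Poly
begin

(* Undirected graphs are symmetric digraphs (locale pair_graph: finite, loop-free, symmetric,
   no parallel arcs): an edge uv is the pair of arcs (u,v), (v,u).  Hence the degree of v
   is the number of arcs leaving v. *)
abbreviation degree_of :: "'a pair_pre_digraph \<Rightarrow> 'a \<Rightarrow> nat" where
  "degree_of G v \<equiv> out_degree (with_proj G) v"

definition randic_entry :: "'a pair_pre_digraph \<Rightarrow> 'a \<Rightarrow> 'a \<Rightarrow> real" where
  "randic_entry G u v =
    (if (u, v) \<in> parcs G then 1 / sqrt (real (degree_of G u) * real (degree_of G v)) else 0)"

definition randic_matrix :: "'a pair_pre_digraph \<Rightarrow> 'a list \<Rightarrow> real mat" where
  "randic_matrix G vs =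
    mat (length vs) (length vs) (\<lambda>(i, j). randic_entry G (vs ! i) (vs ! j))"

definition vertex_enum :: "'a pair_pre_digraph \<Rightarrow> 'a list" where
  "vertex_enum G = (SOME vs. distinct vs \<and> set vs = pverts G)"

(* The roots of the characteristic polynomial, with multiplicity, are all the eigenvalues because
   the Randic matrix is real symmetric.  By randic_energy_eq below, the choice of the
   enumeration is irrelevant. *)
definition randic_energy :: "'a pair_pre_digraph \<Rightarrow> real" where
  "randic_energy G = (\<Sum>x\<in>#proots (char_poly (randic_matrix G (vertex_enum G))). \<bar>x\<bar>)"

definition bipartition :: "'a pair_pre_digraph \<Rightarrow> 'a set \<Rightarrow> 'a set \<Rightarrow> bool" where
  "bipartition G A B \<longleftrightarrow>
    pverts G = A \<union> B \<and> A \<inter> B = {} \<and> parcs G \<subseteq> A \<times> B \<union> B \<times> A"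

definition TB_graph :: "'a pair_pre_digraph \<Rightarrow> bool" where
  "TB_graph G \<longleftrightarrow> pair_graph G \<and> (\<exists>A B. bipartition G A B \<and> (\<forall>b\<in>B. degree_of G b \<le> 2))"

definition star :: "nat \<Rightarrow> nat pair_pre_digraph" where
  "star p = \<lparr>pverts = {0..p}, parcs = {0} \<times> {1..p} \<union> {1..p} \<times> {0}\<rparr>"

(* The edge joining the center 0 to the leaf i is subdivided by the new vertex p + i. *)
definition sun :: "nat \<Rightarrow> nat pair_pre_digraph" where
  "sun p = fold (\<lambda>i H. subdivide H (0, i) (p + i)) [1..<Suc p] (star p)"

lemma pair_graph_star: "pair_graph (star p)"
  by unfold_locales (auto simp: star_def symmetric_def intro: symI)

lemma sun_aux:
  assumes "k \<le> p"
  shows "fold (\<lambda>i H. subdivide H (0, i) (p + i)) [1..<Suc k] (star p) =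
    \<lparr>pverts = {0..p + k},
     parcs = {0} \<times> ({k<..p} \<union> {p<..p + k}) \<union> ({k<..p} \<union> {p<..p + k}) \<times> {0}
       \<union> (\<lambda>i. (p + i, i)) ` {1..k} \<union> (\<lambda>i. (i, p + i)) ` {1..k}\<rparr>"
  using assms
proof (induction k)
  case 0
  then show ?case by (auto simp: star_def)
next
  case (Suc k)
  have up: "[1..<Suc (Suc k)] = [1..<Suc k] @ [Suc k]" by simp
  have "{1..Suc k} = insert (Suc k) {1..k}" by auto
  moreover have "{p<..p + Suc k} = insert (p + Suc k) {p<..p + k}" by auto
  moreover have "{k<..p} = insert (Suc k) {Suc k<..p}" using Suc.prems by auto
  moreover have "{0..p + Suc k} = insert (p + Suc k) {0..p + k}" by auto
  ultimately show ?case
    unfolding up fold_append comp_apply Suc.IH[OF Suc_leD[OF Suc.prems]]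
    using Suc.prems by (auto simp: subdivide.simps)
qed

lemma sun_eq:
  "sun p = \<lparr>pverts = {0..2 * p},
     parcs = {0} \<times> {p<..2 * p} \<union> {p<..2 * p} \<times> {0}
       \<union> (\<lambda>i. (p + i, i)) ` {1..p} \<union> (\<lambda>i. (i, p + i)) ` {1..p}\<rparr>"
  using sun_aux[of p p] by (simp add: sun_def mult_2)

lemma pair_graph_sun: "pair_graph (sun p)"
  by unfold_locales (auto simp: sun_eq symmetric_def intro: symI)

lemma card_sun: "card (pverts (sun p)) = 2 * p + 1"
  by (simp add: sun_eq)

lemma char_poly_randic_matrix_eq:
  assumes "distinct vs" "distinct ws" "set vs = set ws"
  shows "char_poly (randic_matrix G vs) = char_poly (randic_matrix G ws)"
proof -
  define n where "n = length vs"
  have n: "length ws = n" using assms n_def by (metis distinct_card)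
  have "mset vs = mset ws" using assms by (metis set_eq_iff_mset_eq_distinct)
  then obtain f where f: "f permutes {..<n}" and vs: "permute_list f ws = vs"
    using n by (metis mset_eq_permutation)
  define P :: "real mat" where "P = mat n n (\<lambda>(i, j). if j = f i then 1 else 0)"
  define Q :: "real mat" where "Q = mat n n (\<lambda>(i, j). if i = f j then 1 else 0)"
  have fn: "f i < n" if "i < n" for i using f that by (meson lessThan_iff permutes_in_image)
  have inj: "f i = f j \<longleftrightarrow> i = j" for i j using f by (metis permutes_inj injD)
  have nth: "vs ! i = ws ! f i" if "i < n" for i
    using that n f vs by (metis permute_list_nth)
  define M where "M = randic_matrix G ws"
  have carr: "P \<in> carrier_mat n n" "Q \<in> carrier_mat n n" "M \<in> carrier_mat n n"
    by (auto simp: P_def Q_def M_def randic_matrix_def n)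
  have P_mult: "(P * A) $$ (i, j) = A $$ (f i, j)"
    if "A \<in> carrier_mat n n" "i < n" "j < n" for A i j
  proof -
    have "(P * A) $$ (i, j) = (\<Sum>k = 0..<n. (if k = f i then 1 else 0) * A $$ (k, j))"
      using that by (simp add: P_def scalar_prod_def)
    also have "\<dots> = (\<Sum>k = 0..<n. if k = f i then A $$ (k, j) else 0)"
      by (intro sum.cong) auto
    finally show ?thesis using fn[OF that(2)] by simp
  qed
  have mult_Q: "(A * Q) $$ (i, j) = A $$ (i, f j)"
    if "A \<in> carrier_mat n n" "i < n" "j < n" for A i j
  proof -
    have "(A * Q) $$ (i, j) = (\<Sum>k = 0..<n. A $$ (i, k) * (if k = f j then 1 else 0))"
      using that by (simp add: Q_def scalar_prod_def)
    also have "\<dots> = (\<Sum>k = 0..<n. if k = f j then A $$ (i, k) else 0)"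
      by (intro sum.cong) auto
    finally show ?thesis using fn[OF that(3)] by simp
  qed
  have PQ: "P * Q = 1\<^sub>m n"
  proof (rule eq_matI)
    fix i j assume "i < dim_row (1\<^sub>m n :: real mat)" "j < dim_col (1\<^sub>m n :: real mat)"
    then have ij: "i < n" "j < n" by auto
    show "(P * Q) $$ (i, j) = 1\<^sub>m n $$ (i, j)"
      unfolding P_mult[OF carr(2) ij] using ij fn by (simp add: Q_def inj)
  qed (auto simp: P_def Q_def)
  have QP: "Q * P = 1\<^sub>m n" using mat_mult_left_right_inverse[OF carr(1,2) PQ] .
  have "P * M * Q = randic_matrix G vs"
  proof (rule eq_matI)
    fix i j assume "i < dim_row (randic_matrix G vs)" "j < dim_col (randic_matrix G vs)"
    then have ij: "i < n" "j < n" by (auto simp: randic_matrix_def n_def)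
    show "(P * M * Q) $$ (i, j) = randic_matrix G vs $$ (i, j)"
      unfolding mult_Q[OF mult_carrier_mat[OF carr(1,3)] ij] P_mult[OF carr(3) ij(1) fn[OF ij(2)]]
      using ij fn nth by (simp add: M_def randic_matrix_def n n_def[symmetric])
  qed (auto simp: P_def Q_def randic_matrix_def n_def)
  then have "similar_mat_wit (randic_matrix G vs) (randic_matrix G ws) P Q"
    using carr PQ QP unfolding similar_mat_wit_def M_def
    by (simp add: randic_matrix_def n_def[symmetric])
  then show ?thesis by (intro char_poly_similar) (auto simp: similar_mat_def)
qed

lemma randic_energy_eq:
  assumes "distinct vs" "set vs = pverts G"
  shows "randic_energy G = (\<Sum>x\<in>#proots (char_poly (randic_matrix G vs)). \<bar>x\<bar>)"
proof -
  have "distinct (vertex_enum G) \<and> set (vertex_enum G) = pverts G"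
    unfolding vertex_enum_def by (rule someI[where x = vs]) (use assms in auto)
  then show ?thesis
    unfolding randic_energy_def
    using char_poly_randic_matrix_eq[of "vertex_enum G" vs G] assms by simp
qed

end

theory Submission
  imports Defs "Jordan_Normal_Form.Schur_Decomposition"
begin

text \<open>
  Let \<open>R\<close> be the Randic matrix of a connected TB graph with \<open>n = 2 p + 1\<close> vertices. Since \<open>R\<close> is real and
  symmetric, all its eigenvalues are real, and the sum of their \<open>k\<close>-th powers is the trace of \<open>R\<^sup>k\<close>
  (\<open>sum_list_roots_power\<close>). Three eigenvalues are forced: 1 and -1, with the square roots of the
  degrees as eigenvector, up to a change of sign on one side of the bipartition
  (\<open>randic_sqrt_degree\<close>), and 0, because a bipartite graph of odd order has a singular Randic matrix
  (\<open>bipartite_odd_kernel\<close>).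

  The trace of \<open>R\<^sup>2\<close> is the sum of \<open>1 / (d u * d v)\<close> over all arcs. On every edge of a connected
  TB graph one end has degree at most 2 and the other at least 2, so
  \<open>(1 / d u - 1/2) (1 / d v - 1/2) \<le> 0\<close>. Summing this over the arcs, of which there are at least
  \<open>2 (n - 1)\<close>, shows that the trace is at most \<open>p + 1\<close> (\<open>TB_trace_bound\<close>). The
  \<open>2 p - 2\<close> eigenvalues that remain after removing 0, 1 and -1 therefore have squares with sum at most
  \<open>p - 1\<close>. Bounding the absolute value by a quadratic function that touches it at
  \<open>1 / sqrt 2\<close> gives at most \<open>sqrt 2 (p - 1)\<close> for the sum of their absolute values, hence
  \<open>2 + sqrt 2 (p - 1)\<close> for the energy (\<open>sum_abs_le_of_sum_squares\<close>).

  The sun attains this value (\<open>randic_energy_sun\<close>). Its eigenvalues lie among 0, 1, -1 and the two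
  square roots of \<open>1/2\<close>. On these points the absolute value coincides with a combination of
  \<open>x\<^sup>2\<close> and \<open>x\<^sup>4\<close>, so the energy follows from the traces of \<open>R\<^sup>2\<close> and \<open>R\<^sup>4\<close>, without
  determining any multiplicity.
\<close>

section \<open>Traces, power sums and real spectra\<close>

lemma sum_list_diag_mat:
  "A \<in> carrier_mat n n \<Longrightarrow> sum_list (diag_mat A) = (\<Sum>i<n. A $$ (i, i))"
  by (simp add: diag_mat_def sum_list_sum_nth lessThan_atLeast0)

lemma trace_mult_commute:
  fixes A B :: "'a :: comm_ring_1 mat"
  assumes "A \<in> carrier_mat n n" "B \<in> carrier_mat n n"
  shows "sum_list (diag_mat (A * B)) = sum_list (diag_mat (B * A))"
proof -
  have "sum_list (diag_mat (A * B)) = (\<Sum>i<n. \<Sum>j<n. A $$ (i, j) * B $$ (j, i))"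
    using assms by (simp add: sum_list_diag_mat[of _ n] scalar_prod_def lessThan_atLeast0)
  also have "\<dots> = (\<Sum>i<n. \<Sum>j<n. B $$ (i, j) * A $$ (j, i))"
    by (subst sum.swap) (simp add: mult.commute)
  also have "\<dots> = sum_list (diag_mat (B * A))"
    using assms by (simp add: sum_list_diag_mat[of _ n] scalar_prod_def lessThan_atLeast0)
  finally show ?thesis .
qed

text \<open>In the trace of \<open>P B Q\<close>, the factor \<open>P\<close> can be moved cyclically to the right, where it cancels \<open>Q\<close>.\<close>

lemma trace_similar:
  fixes A B :: "'a :: comm_ring_1 mat"
  assumes "similar_mat_wit A B P Q"
  shows "sum_list (diag_mat A) = sum_list (diag_mat B)"
proof -
  define n where "n = dim_row A"
  note w = similar_mat_witD[OF n_def assms]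
  have "sum_list (diag_mat A) = sum_list (diag_mat (P * (B * Q)))"
    using w by (simp add: assoc_mult_mat[of _ n n _ n _ n])
  also have "\<dots> = sum_list (diag_mat ((B * Q) * P))"
    using w by (intro trace_mult_commute[of _ n]) auto
  also have "(B * Q) * P = B"
    using w by (simp add: assoc_mult_mat[of _ n n _ n _ n])
  finally show ?thesis .
qed

text \<open>Of the products summed up in an entry of \<open>B\<^sup>k B\<close> on or below the diagonal, only the one made of two
  diagonal entries can be nonzero.\<close>

lemma upper_triangular_pow:
  fixes B :: "'a :: comm_ring_1 mat"
  assumes "B \<in> carrier_mat n n" "upper_triangular B"
  shows "upper_triangular (B ^\<^sub>m k) \<and> (\<forall>i<n. (B ^\<^sub>m k) $$ (i, i) = (B $$ (i, i)) ^ k)"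
proof (induction k)
  case 0
  then show ?case using assms by auto
next
  case (Suc k)
  have C: "B ^\<^sub>m k \<in> carrier_mat n n" using assms by auto
  have entry: "(B ^\<^sub>m Suc k) $$ (i, j) = (\<Sum>l<n. (B ^\<^sub>m k) $$ (i, l) * B $$ (l, j))"
    if "i < n" "j < n" for i j
    using that assms C by (simp add: scalar_prod_def lessThan_atLeast0)
  have zero: "(B ^\<^sub>m k) $$ (i, l) * B $$ (l, j) = 0" if "j \<le> i" "i < n" "l < n" "l \<noteq> i \<or> j \<noteq> i" for i j l
    using that Suc assms C upper_triangularD[of "B ^\<^sub>m k" l i] upper_triangularD[of B j l]
    by (cases "l < i") auto
  have "(B ^\<^sub>m Suc k) $$ (i, j) = 0" if "j < i" "i < n" for i j
    using that by (subst entry) (auto intro!: sum.neutral zero)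
  moreover have "(B ^\<^sub>m Suc k) $$ (i, i) = (B $$ (i, i)) ^ Suc k" if "i < n" for i
  proof -
    have "(B ^\<^sub>m Suc k) $$ (i, i) = (\<Sum>l\<in>{i}. (B ^\<^sub>m k) $$ (i, l) * B $$ (l, i))"
      unfolding entry[OF that that] using that by (intro sum.mono_neutral_right) (auto intro!: zero)
    then show ?thesis using Suc that by (simp add: mult.commute)
  qed
  ultimately show ?case using assms by (auto intro!: upper_triangularI)
qed

text \<open>Power sums of eigenvalues are read off from traces: both sides are invariant under similarity, and by
  Schur's theorem \<open>A\<close> is similar to a triangular matrix with diagonal \<open>es\<close>.\<close>

lemma sum_list_roots_power:
  fixes A :: "real mat"
  assumes A: "A \<in> carrier_mat n n" and es: "char_poly A = (\<Prod>e\<leftarrow>es. [:- e, 1:])"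
  shows "(\<Sum>e\<leftarrow>es. e ^ k) = sum_list (diag_mat (A ^\<^sub>m k))"
proof -
  obtain B P Q where "schur_decomposition A es = (B, P, Q)" by (metis prod_cases3)
  from schur_decomposition[OF A es this]
  have sim: "similar_mat_wit A B P Q" and B: "upper_triangular B" "diag_mat B = es" by auto
  have Bc: "B \<in> carrier_mat n n" using similar_mat_witD2[OF A sim] by simp
  have "(\<Sum>e\<leftarrow>es. e ^ k) = (\<Sum>i<n. (B $$ (i, i)) ^ k)"
    using Bc unfolding B(2)[symmetric] by (simp add: diag_mat_def sum_list_sum_nth lessThan_atLeast0)
  also have "\<dots> = sum_list (diag_mat (B ^\<^sub>m k))"
    using Bc upper_triangular_pow[OF Bc B(1)] by (simp add: sum_list_diag_mat[of _ n])
  also have "\<dots> = sum_list (diag_mat (A ^\<^sub>m k))"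
    using trace_similar[OF similar_mat_wit_pow[OF sim]] by simp
  finally show ?thesis .
qed

text \<open>The usual Hermitian form argument: for an eigenvector \<open>v\<close> of \<open>z\<close>, the number
  \<open>v\<^sup>* A v = z (v\<^sup>* v)\<close> is its own conjugate by symmetry of \<open>A\<close>, and \<open>v\<^sup>* v\<close> is real and nonzero.\<close>

lemma real_symmetric_eigenvalue_Reals:
  fixes A :: "real mat"
  assumes A: "A \<in> carrier_mat n n"
    and sym: "\<And>i j. i < n \<Longrightarrow> j < n \<Longrightarrow> A $$ (i, j) = A $$ (j, i)"
    and ev: "eigenvalue (map_mat complex_of_real A) z"
  shows "cnj z = z"
proof -
  let ?C = "map_mat complex_of_real A"
  obtain v where v: "v \<in> carrier_vec n" "v \<noteq> 0\<^sub>v n" "?C *\<^sub>v v = z \<cdot>\<^sub>v v"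
    using ev A unfolding eigenvalue_def eigenvector_def by auto
  have row: "(\<Sum>j<n. of_real (A $$ (i, j)) * v $ j) = z * v $ i" if "i < n" for i
    using arg_cong[OF v(3), of "\<lambda>w. w $ i"] that v(1) A
    by (simp add: scalar_prod_def lessThan_atLeast0)
  \<comment> \<open>The Hermitian form of \<open>A\<close> at \<open>v\<close> and the squared norm of \<open>v\<close>.\<close>
  define q where "q = (\<Sum>i<n. \<Sum>j<n. cnj (v $ i) * of_real (A $$ (i, j)) * v $ j)"
  define N where "N = (\<Sum>i<n. cnj (v $ i) * v $ i)"
  have q: "q = z * N"
    unfolding q_def N_def sum_distrib_left
    by (intro sum.cong refl) (simp add: row sum_distrib_left[symmetric] mult.assoc)
  have "cnj q = (\<Sum>i<n. \<Sum>j<n. v $ i * of_real (A $$ (i, j)) * cnj (v $ j))"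
    unfolding q_def by (simp add: cnj_sum)
  also have "\<dots> = q"
    unfolding q_def by (subst sum.swap) (auto intro!: sum.cong simp: sym)
  finally have "cnj q = q" .
  moreover have "cnj N = N" unfolding N_def by (simp add: cnj_sum mult.commute)
  moreover have "N \<noteq> 0"
  proof
    assume "N = 0"
    have N': "N = of_real (\<Sum>i<n. (cmod (v $ i))\<^sup>2)"
      unfolding N_def of_real_sum by (intro sum.cong refl) (simp only: complex_norm_square mult.commute)
    have "(\<Sum>i<n. (cmod (v $ i))\<^sup>2) = 0" using \<open>N = 0\<close> unfolding N' of_real_eq_0_iff .
    then have "v $ i = 0" if "i < n" for i using that by (simp add: sum_nonneg_eq_0_iff)
    then have "v = 0\<^sub>v n" using v(1) by (intro eq_vecI) auto
    with v(2) show False by simp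
  qed
  ultimately show ?thesis using q by simp
qed

lemma real_symmetric_char_poly_splits:
  fixes A :: "real mat"
  assumes A: "A \<in> carrier_mat n n"
    and sym: "\<And>i j. i < n \<Longrightarrow> j < n \<Longrightarrow> A $$ (i, j) = A $$ (j, i)"
  obtains es where "char_poly A = (\<Prod>e\<leftarrow>es. [:- e, 1:])" "length es = n"
proof -
  let ?C = "map_mat complex_of_real A"
  have C: "?C \<in> carrier_mat n n" using A by simp
  obtain zs where zs: "char_poly ?C = (\<Prod>z\<leftarrow>zs. [:- z, 1:])" "length zs = n"
    using char_poly_factorized[OF C] by blast
  have real: "of_real (Re z) = z" if "z \<in> set zs" for z
  proof -
    have "poly (char_poly ?C) z = 0"
      unfolding zs poly_prod_list prod_list_zero_iff using that by force
    then have "eigenvalue ?C z" using eigenvalue_root_char_poly[OF C] by simp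
    from real_symmetric_eigenvalue_Reals[OF A sym this] show ?thesis
      by (simp add: complex_eq_iff)
  qed
  interpret of_real_poly: map_poly_inj_comm_ring_hom complex_of_real ..
  have "map_poly complex_of_real (char_poly A) = char_poly ?C"
    by (rule of_real_hom.char_poly_hom[OF A, symmetric])
  also have "\<dots> = (\<Prod>z\<leftarrow>zs. map_poly complex_of_real [:- Re z, 1:])"
    unfolding zs by (intro arg_cong[where f = prod_list] map_cong refl) (simp add: real)
  also have "\<dots> = map_poly complex_of_real (\<Prod>e\<leftarrow>map Re zs. [:- e, 1:])"
    by (simp add: of_real_poly.hom_prod_list o_def)
  finally have "char_poly A = (\<Prod>e\<leftarrow>map Re zs. [:- e, 1:])"
    by simp
  with zs(2) show ?thesis by (intro that[of "map Re zs"]) auto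
qed

section \<open>The spectrum of the Randic matrix\<close>

text \<open>Working with a kernel on the vertices instead of a matrix on list positions turns products, traces
  and eigenvector equations into sums over the vertex set, in which the enumeration no longer occurs.\<close>

definition indexed_mat :: "'v list \<Rightarrow> ('v \<Rightarrow> 'v \<Rightarrow> 'a) \<Rightarrow> 'a mat" where
  "indexed_mat vs f = mat (length vs) (length vs) (\<lambda>(i, j). f (vs ! i) (vs ! j))"

lemma randic_matrix_indexed: "randic_matrix G vs = indexed_mat vs (randic_entry G)"
  by (simp add: randic_matrix_def indexed_mat_def)

lemma indexed_mat_carrier [simp]: "indexed_mat vs f \<in> carrier_mat (length vs) (length vs)"
  by (simp add: indexed_mat_def)

lemma sum_nth_set:
  "distinct vs \<Longrightarrow> (\<Sum>i<length vs. h (vs ! i)) = (\<Sum>v\<in>set vs. h v)"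
  by (rule sum.reindex_bij_betw[OF bij_betw_nth]) auto

lemma indexed_mat_mult:
  fixes f g :: "'v \<Rightarrow> 'v \<Rightarrow> 'a :: semiring_0"
  assumes "distinct vs"
  shows "indexed_mat vs f * indexed_mat vs g = indexed_mat vs (\<lambda>u w. \<Sum>v\<in>set vs. f u v * g v w)"
  by (rule eq_matI)
    (auto simp: indexed_mat_def scalar_prod_def lessThan_atLeast0[symmetric] sum_nth_set[OF assms, symmetric])

lemma trace_indexed_mat:
  fixes f :: "'v \<Rightarrow> 'v \<Rightarrow> 'a :: comm_ring_1"
  assumes "distinct vs"
  shows "sum_list (diag_mat (indexed_mat vs f)) = (\<Sum>v\<in>set vs. f v v)"
  using sum_list_diag_mat[OF indexed_mat_carrier[of vs f]] sum_nth_set[OF assms, of "\<lambda>v. f v v"]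
  by (simp add: indexed_mat_def)

lemma eigenvalue_indexed_mat_iff:
  fixes f :: "'v \<Rightarrow> 'v \<Rightarrow> 'a :: comm_ring_1"
  assumes "distinct vs"
  shows "eigenvalue (indexed_mat vs f) k \<longleftrightarrow>
    (\<exists>x. (\<exists>v\<in>set vs. x v \<noteq> 0) \<and> (\<forall>u\<in>set vs. (\<Sum>v\<in>set vs. f u v * x v) = k * x u))"
    (is "_ \<longleftrightarrow> ?R")
proof
  assume "eigenvalue (indexed_mat vs f) k"
  then obtain w where w: "w \<in> carrier_vec (length vs)" "w \<noteq> 0\<^sub>v (length vs)"
    "indexed_mat vs f *\<^sub>v w = k \<cdot>\<^sub>v w"
    by (auto simp: eigenvalue_def eigenvector_def indexed_mat_def)
  define x where "x v = w $ (THE i. i < length vs \<and> vs ! i = v)" for v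
  have x: "x (vs ! i) = w $ i" if "i < length vs" for i
    unfolding x_def using that assms
    by (intro arg_cong[of _ _ "\<lambda>i. w $ i"] the_equality) (auto simp: nth_eq_iff_index_eq)
  have "(\<Sum>v\<in>set vs. f (vs ! i) v * x v) = k * x (vs ! i)" if "i < length vs" for i
    using arg_cong[OF w(3), of "\<lambda>w. w $ i"] that w(1)
    by (simp add: indexed_mat_def scalar_prod_def lessThan_atLeast0[symmetric] x
        sum_nth_set[OF assms, symmetric])
  moreover obtain i where "i < length vs" "w $ i \<noteq> 0"
    using w(1,2) by (metis carrier_vecD eq_vecI index_zero_vec)
  ultimately show ?R
    by (intro exI[of _ x] conjI bexI[of _ "vs ! i"]) (auto simp: x in_set_conv_nth)
next
  assume ?R
  then obtain x where x: "\<exists>v\<in>set vs. x v \<noteq> 0"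
    "\<And>u. u \<in> set vs \<Longrightarrow> (\<Sum>v\<in>set vs. f u v * x v) = k * x u" by blast
  define w where "w = vec (length vs) (\<lambda>i. x (vs ! i))"
  have "w \<noteq> 0\<^sub>v (length vs)"
    using x(1) unfolding w_def by (metis in_set_conv_nth index_vec index_zero_vec(1))
  moreover have "indexed_mat vs f *\<^sub>v w = k \<cdot>\<^sub>v w"
    using x(2)[OF nth_mem]
    by (intro eq_vecI) (auto simp: w_def indexed_mat_def scalar_prod_def lessThan_atLeast0[symmetric]
        sum_nth_set[OF assms, symmetric])
  ultimately show "eigenvalue (indexed_mat vs f) k"
    unfolding eigenvalue_def eigenvector_def by (intro exI[of _ w]) (simp add: w_def indexed_mat_def)
qed

lemma randic_entry_commute:
  assumes "pair_graph G"
  shows "randic_entry G u v = randic_entry G v u"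
proof -
  interpret pair_graph G by fact
  have "(u, v) \<in> parcs G \<longleftrightarrow> (v, u) \<in> parcs G"
    using arcs_symmetric by blast
  then show ?thesis by (simp add: randic_entry_def mult.commute)
qed

text \<open>The passage from the matrix to the graph: the spectrum as a list, with multiplicity, together with
  descriptions of its members and of its second and fourth moments that mention only the graph.\<close>

lemma randic_spectrum:
  assumes "pair_graph G"
  obtains es where
    "randic_energy G = (\<Sum>e\<leftarrow>es. \<bar>e\<bar>)"
    "length es = card (pverts G)"
    "\<And>x. x \<in> set es \<longleftrightarrow> (\<exists>f. (\<exists>v\<in>pverts G. f v \<noteq> 0) \<and>
        (\<forall>u\<in>pverts G. (\<Sum>v\<in>pverts G. randic_entry G u v * f v) = x * f u))"
    "(\<Sum>e\<leftarrow>es. e ^ 2) = (\<Sum>u\<in>pverts G. \<Sum>v\<in>pverts G. (randic_entry G u v)\<^sup>2)"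
    "(\<Sum>e\<leftarrow>es. e ^ 4) =
      (\<Sum>u\<in>pverts G. \<Sum>w\<in>pverts G. (\<Sum>v\<in>pverts G. randic_entry G u v * randic_entry G v w)\<^sup>2)"
proof -
  interpret pair_graph G by fact
  let ?r = "randic_entry G"
  obtain vs where vs: "distinct vs" "set vs = pverts G"
    using finite_distinct_list[OF pair_finite_verts] by blast
  define R where "R = randic_matrix G vs"
  have R: "R = indexed_mat vs ?r" by (simp add: R_def randic_matrix_indexed)
  have carr: "R \<in> carrier_mat (length vs) (length vs)" by (simp add: R)
  have "R $$ (i, j) = R $$ (j, i)" if "i < length vs" "j < length vs" for i j
    using that by (simp add: R indexed_mat_def randic_entry_commute[OF assms])
  then obtain es where es: "char_poly R = (\<Prod>e\<leftarrow>es. [:- e, 1:])" "length es = length vs"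
    using real_symmetric_char_poly_splits[OF carr] by metis
  have "proots (char_poly R) = mset es"
    unfolding es by (induction es) (simp_all add: proots_mult prod_list_zero_iff image_iff del: mult_pCons_left)
  then have 1: "randic_energy G = (\<Sum>e\<leftarrow>es. \<bar>e\<bar>)"
    using randic_energy_eq[OF vs] by (simp add: R_def sum_mset_sum_list[symmetric])
  have 2: "length es = card (pverts G)" using es(2) vs distinct_card by metis
  have "x \<in> set es \<longleftrightarrow> eigenvalue R x" for x
    unfolding eigenvalue_root_char_poly[OF carr] es poly_prod_list prod_list_zero_iff by (auto simp: image_iff)
  then have 3: "x \<in> set es \<longleftrightarrow> (\<exists>f. (\<exists>v\<in>pverts G. f v \<noteq> 0) \<and>
        (\<forall>u\<in>pverts G. (\<Sum>v\<in>pverts G. ?r u v * f v) = x * f u))" for x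
    unfolding R using eigenvalue_indexed_mat_iff[OF vs(1), of ?r x] vs(2) by simp
  define s where "s u w = (\<Sum>v\<in>pverts G. ?r u v * ?r v w)" for u w
  have RR: "R * R = indexed_mat vs s"
    unfolding R s_def using indexed_mat_mult[OF vs(1), of ?r ?r] vs(2) by simp
  have p2: "R ^\<^sub>m 2 = R * R" using carr by (simp add: numeral_2_eq_2)
  have p4: "R ^\<^sub>m 4 = (R * R) * (R * R)"
    using carr by (simp add: numeral_eq_Suc assoc_mult_mat[of _ "length vs" "length vs" _ "length vs" _ "length vs"])
  have 4: "(\<Sum>e\<leftarrow>es. e ^ 2) = (\<Sum>u\<in>pverts G. \<Sum>v\<in>pverts G. (?r u v)\<^sup>2)"
    unfolding sum_list_roots_power[OF carr es(1)] p2 RR trace_indexed_mat[OF vs(1)] vs(2) s_def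
    by (intro sum.cong refl) (simp add: power2_eq_square randic_entry_commute[OF assms, of _ _])
  have comm: "s w u = s u w" for u w
    unfolding s_def by (intro sum.cong refl) (metis assms mult.commute randic_entry_commute)
  have 5: "(\<Sum>e\<leftarrow>es. e ^ 4) = (\<Sum>u\<in>pverts G. \<Sum>w\<in>pverts G. (s u w)\<^sup>2)"
    unfolding sum_list_roots_power[OF carr es(1)] p4 RR indexed_mat_mult[OF vs(1)]
      trace_indexed_mat[OF vs(1)] vs(2) power2_eq_square
    by (intro sum.cong refl) (metis comm)
  show ?thesis using that[OF 1 2 3 4 5[unfolded s_def]] .
qed

section \<open>The energy of the sun\<close>

lemma if_zero_arith:
  fixes c y :: real
  shows "(if b then c else 0) * y = (if b then c * y else 0)"
    "y * (if b then c else 0) = (if b then y * c else 0)"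
    "(if b then c else 0)\<^sup>2 = (if b then c\<^sup>2 else 0)"
    "(if b then c else 0) / y = (if b then c / y else 0)"
  by auto

lemma degree_of_eq: "degree_of G u = card {v. (u, v) \<in> parcs G}"
proof -
  have "out_arcs (with_proj G) u = Pair u ` {v. (u, v) \<in> parcs G}"
    by (auto simp: out_arcs_def with_proj_def)
  then show ?thesis by (simp add: out_degree_def card_image inj_on_def)
qed

lemma degree_of_sun:
  "degree_of (sun p) 0 = p"
  "i \<in> {1..p} \<Longrightarrow> degree_of (sun p) i = 1"
  "i \<in> {1..p} \<Longrightarrow> degree_of (sun p) (p + i) = 2"
proof -
  have "{v. (0, v) \<in> parcs (sun p)} = {p<..2 * p}" by (auto simp: sun_eq)
  then show "degree_of (sun p) 0 = p" by (simp add: degree_of_eq)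
next
  assume i: "i \<in> {1..p}"
  then have "{v. (i, v) \<in> parcs (sun p)} = {p + i}" by (auto simp: sun_eq)
  then show "degree_of (sun p) i = 1" by (simp add: degree_of_eq)
  from i have "{v. (p + i, v) \<in> parcs (sun p)} = {0, i}" by (auto simp: sun_eq)
  then show "degree_of (sun p) (p + i) = 2" using i by (simp add: degree_of_eq)
qed

lemma randic_entry_sun:
  fixes p :: nat
  defines "r \<equiv> randic_entry (sun p)"
  shows "r 0 0 = 0"
    and "i \<in> {1..p} \<Longrightarrow> r 0 i = 0" "i \<in> {1..p} \<Longrightarrow> r i 0 = 0"
    and "i \<in> {1..p} \<Longrightarrow> r 0 (p + i) = 1 / sqrt (2 * p)"
    and "i \<in> {1..p} \<Longrightarrow> r (p + i) 0 = 1 / sqrt (2 * p)"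
    and "i \<in> {1..p} \<Longrightarrow> j \<in> {1..p} \<Longrightarrow> r i j = 0"
    and "i \<in> {1..p} \<Longrightarrow> j \<in> {1..p} \<Longrightarrow> r i (p + j) = (if i = j then 1 / sqrt 2 else 0)"
    and "i \<in> {1..p} \<Longrightarrow> j \<in> {1..p} \<Longrightarrow> r (p + i) j = (if i = j then 1 / sqrt 2 else 0)"
    and "i \<in> {1..p} \<Longrightarrow> j \<in> {1..p} \<Longrightarrow> r (p + i) (p + j) = 0"
  unfolding r_def randic_entry_def degree_of_sun
  by (auto simp: degree_of_sun degree_of_sun(2,3)[unfolded One_nat_def] mult.commute sun_eq)

lemma sum_sun:
  "(\<Sum>v\<in>pverts (sun p). h v) = h 0 + (\<Sum>i\<in>{1..p}. h i) + (\<Sum>i\<in>{1..p}. h (p + i))"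
proof -
  have V: "pverts (sun p) = insert 0 ({1..p} \<union> (+) p ` {1..p})"
    by (auto simp: sun_eq image_add_atLeastAtMost)
  have "(\<Sum>v\<in>(+) p ` {1..p}. h v) = (\<Sum>i\<in>{1..p}. h (p + i))"
    by (subst sum.reindex) (auto simp: o_def)
  then show ?thesis
    unfolding V by (subst sum.insert) (auto simp: sum.union_disjoint add.assoc)
qed

lemma randic_sun_trace_2:
  assumes "p \<ge> 1"
  shows "(\<Sum>u\<in>pverts (sun p). \<Sum>v\<in>pverts (sun p). (randic_entry (sun p) u v)\<^sup>2) = p + 1"
  using assms
  by (simp add: sum_sun randic_entry_sun sum.distrib if_zero_arith power_divide cong: if_cong)

text \<open>The square of the Randic matrix has nonzero entries only between vertices at distance 0 or 2, so the
  sum splits into the center, the pairs of center and leaf, the leaves, and the pairs of middle vertices.\<close>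

lemma randic_sun_trace_4:
  assumes "p \<ge> 1"
  shows "(\<Sum>u\<in>pverts (sun p). \<Sum>w\<in>pverts (sun p).
    (\<Sum>v\<in>pverts (sun p). randic_entry (sun p) u v * randic_entry (sun p) v w)\<^sup>2) = (p + 3) / 2"
proof -
  define s where
    "s u w = (\<Sum>v\<in>pverts (sun p). randic_entry (sun p) u v * randic_entry (sun p) v w)" for u w
  have s_center: "s 0 0 = 1 / 2"
    using assms by (simp add: s_def sum_sun randic_entry_sun)
  have s_center_leaf: "s 0 i = 1 / (2 * sqrt p)" "s i 0 = 1 / (2 * sqrt p)" if "i \<in> {1..p}" for i
    using that by (simp_all add: s_def sum_sun randic_entry_sun real_sqrt_mult if_zero_arith cong: if_cong)
  have s_leaf: "s i j = (if i = j then 1 / 2 else 0)" if "i \<in> {1..p}" "j \<in> {1..p}" for i j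
    using that by (simp add: s_def sum_sun randic_entry_sun if_zero_arith cong: if_cong)
  have s_middle: "s (p + i) (p + j) = 1 / (2 * p) + (if i = j then 1 / 2 else 0)"
    if "i \<in> {1..p}" "j \<in> {1..p}" for i j
    using that assms by (simp add: s_def sum_sun randic_entry_sun if_zero_arith cong: if_cong)
  have s_zero: "s 0 (p + i) = 0" "s (p + i) 0 = 0" "s i (p + j) = 0" "s (p + j) i = 0"
    if "i \<in> {1..p}" "j \<in> {1..p}" for i j
    using that by (simp_all add: s_def sum_sun randic_entry_sun)
  have s: "(\<Sum>u\<in>pverts (sun p). \<Sum>w\<in>pverts (sun p). (s u w)\<^sup>2) =
     1 / 4 + 2 * (\<Sum>i\<in>{1..p}. (1 / (2 * sqrt p))\<^sup>2)
     + (\<Sum>i\<in>{1..p}. \<Sum>j\<in>{1..p}. if i = j then 1 / 4 else 0)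
     + (\<Sum>i\<in>{1..p}. \<Sum>j\<in>{1..p}. (1 / (2 * p) + (if i = j then 1 / 2 else 0))\<^sup>2)"
    by (simp add: sum_sun sum.distrib power_divide if_zero_arith s_center s_center_leaf s_leaf s_middle s_zero
        cong: if_cong)
  have "(\<Sum>j\<in>{1..p}. (1 / (2 * p) + (if i = j then 1 / 2 else 0 :: real))\<^sup>2) = 1 / (4 * p) + 1 / (2 * p) + 1 / 4"
    if "i \<in> {1..p}" for i
  proof -
    have "(\<Sum>j\<in>{1..p}. (1 / (2 * p) + (if i = j then 1 / 2 else 0 :: real))\<^sup>2) =
      (\<Sum>j\<in>{1..p}. 1 / (4 * p ^ 2) + (if i = j then 1 / (2 * p) + 1 / 4 else 0))"
      by (intro sum.cong refl) (auto simp: power2_eq_square field_simps)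
    also have "\<dots> = 1 / (4 * p) + 1 / (2 * p) + 1 / 4"
      using that by (simp add: sum.distrib power2_eq_square)
    finally show ?thesis .
  qed
  then show ?thesis
    using assms unfolding s_def[symmetric] s by (simp add: power_divide power_mult_distrib) (simp add: field_simps)
qed

text \<open>Multiplying the equation at a middle vertex by \<open>x\<close> eliminates its leaf and leaves
  \<open>(x\<^sup>2 - 1/2) f (p + i) = x f 0 / sqrt (2 p)\<close>. Summing over all middle vertices eliminates these as well:
  \<open>(x\<^sup>2 - 1) x f 0 = 0\<close>. Outside the listed values, \<open>f\<close> thus vanishes at the center, hence at
  the middle vertices, hence at the leaves.\<close>

lemma randic_sun_eigenvalue:
  assumes p: "p \<ge> 1" and nz: "\<exists>v\<in>pverts (sun p). f v \<noteq> 0"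
    and ev: "\<And>u. u \<in> pverts (sun p) \<Longrightarrow> (\<Sum>v\<in>pverts (sun p). randic_entry (sun p) u v * f v) = x * f u"
  shows "x = 0 \<or> x\<^sup>2 = 1 \<or> x\<^sup>2 = 1 / 2"
proof (rule ccontr)
  assume neg: "\<not> ?thesis"
  have V: "0 \<in> pverts (sun p)" "i \<in> {1..p} \<Longrightarrow> i \<in> pverts (sun p)" "i \<in> {1..p} \<Longrightarrow> p + i \<in> pverts (sun p)" for i
    by (auto simp: sun_eq)
  have center: "x * f 0 = (\<Sum>i\<in>{1..p}. f (p + i)) / sqrt (2 * p)"
    using ev[OF V(1)] by (simp add: sum_sun randic_entry_sun sum_divide_distrib)
  have leaf: "x * f i = f (p + i) / sqrt 2" if "i \<in> {1..p}" for i
    using ev[OF V(2)[OF that]] that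
    by (simp add: sum_sun randic_entry_sun if_zero_arith cong: if_cong)
  have middle: "x * f (p + i) = f 0 / sqrt (2 * p) + f i / sqrt 2" if "i \<in> {1..p}" for i
    using ev[OF V(3)[OF that]] that
    by (simp add: sum_sun randic_entry_sun if_zero_arith cong: if_cong)
  have m: "(x\<^sup>2 - 1 / 2) * f (p + i) = x * f 0 / sqrt (2 * p)" if "i \<in> {1..p}" for i
  proof -
    have "x\<^sup>2 * f (p + i) = x * (f 0 / sqrt (2 * p) + f i / sqrt 2)"
      using middle[OF that] by (simp add: power2_eq_square mult.assoc)
    also have "\<dots> = x * f 0 / sqrt (2 * p) + (x * f i) / sqrt 2"
      by (simp add: distrib_left)
    also have "(x * f i) / sqrt 2 = f (p + i) / 2"
      unfolding leaf[OF that] by simp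
    finally show ?thesis by (simp add: left_diff_distrib)
  qed
  have "(x\<^sup>2 - 1 / 2) * (x * f 0) = (\<Sum>i\<in>{1..p}. (x\<^sup>2 - 1 / 2) * f (p + i)) / sqrt (2 * p)"
    unfolding center by (simp add: sum_distrib_left)
  also have "\<dots> = p * (x * f 0 / sqrt (2 * p)) / sqrt (2 * p)"
    using m by simp
  also have "\<dots> = x * f 0 / 2" using p by (simp add: field_simps)
  finally have "(x\<^sup>2 - 1) * (x * f 0) = 0" by (simp add: algebra_simps)
  then have f0: "f 0 = 0" using neg by auto
  then have fm: "f (p + i) = 0" if "i \<in> {1..p}" for i using m[OF that] neg by auto
  then have "f i = 0" if "i \<in> {1..p}" for i using leaf[OF that] that neg by auto
  moreover have "v = 0 \<or> v \<in> {1..p} \<or> (\<exists>i\<in>{1..p}. v = p + i)" if "v \<in> pverts (sun p)" for v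
    using that by (cases "v \<le> p") (auto simp: sun_eq intro!: bexI[of _ "v - p"])
  ultimately show False using nz f0 fm by blast
qed

text \<open>Makes the energy of the sun a combination of traces. The two coefficients are determined by the values
  of the absolute value at \<open>1\<close> and \<open>1 / sqrt 2\<close>.\<close>

lemma abs_eq_quartic:
  fixes x :: real
  assumes "x = 0 \<or> x\<^sup>2 = 1 \<or> x\<^sup>2 = 1 / 2"
  shows "\<bar>x\<bar> = (2 * sqrt 2 - 1) * x ^ 2 + (2 - 2 * sqrt 2) * x ^ 4"
proof -
  have half: "sqrt (1 / 2) = sqrt 2 / 2"
    by (rule real_sqrt_unique) (simp_all add: power_divide)
  have "sqrt y = (2 * sqrt 2 - 1) * y + (2 - 2 * sqrt 2) * y\<^sup>2"
    if "y = 0 \<or> y = 1 \<or> y = 1 / 2" for y :: real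
    using that by (elim disjE) (simp_all only: half, simp_all add: power_divide algebra_simps)
  from this[of "x\<^sup>2"] assms show ?thesis by (auto simp flip: power_mult)
qed

lemma randic_energy_sun:
  assumes "p \<ge> 1"
  shows "randic_energy (sun p) = 2 + sqrt 2 * (real p - 1)"
proof -
  obtain es :: "real list" where es:
    "randic_energy (sun p) = (\<Sum>e\<leftarrow>es. \<bar>e\<bar>)"
    "\<And>x. x \<in> set es \<longleftrightarrow> (\<exists>f. (\<exists>v\<in>pverts (sun p). f v \<noteq> 0) \<and>
        (\<forall>u\<in>pverts (sun p). (\<Sum>v\<in>pverts (sun p). randic_entry (sun p) u v * f v) = x * f u))"
    and moments: "(\<Sum>e\<leftarrow>es. e ^ 2) = real p + 1" "(\<Sum>e\<leftarrow>es. e ^ 4) = (real p + 3) / 2"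
    by (rule randic_spectrum[OF pair_graph_sun[of p]])
      (rule that; simp add: randic_sun_trace_2[OF assms] randic_sun_trace_4[OF assms])
  have "\<bar>e\<bar> = (2 * sqrt 2 - 1) * e ^ 2 + (2 - 2 * sqrt 2) * e ^ 4" if e: "e \<in> set es" for e
  proof -
    obtain f where "\<exists>v\<in>pverts (sun p). f v \<noteq> 0"
      "\<And>u. u \<in> pverts (sun p) \<Longrightarrow> (\<Sum>v\<in>pverts (sun p). randic_entry (sun p) u v * f v) = e * f u"
      using e unfolding es(2) by blast
    from abs_eq_quartic[OF randic_sun_eigenvalue[OF assms this]] show ?thesis .
  qed
  then have "randic_energy (sun p) = (\<Sum>e\<leftarrow>es. (2 * sqrt 2 - 1) * e ^ 2 + (2 - 2 * sqrt 2) * e ^ 4)"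
    unfolding es(1) by (intro arg_cong[where f = sum_list] map_cong) auto
  also have "\<dots> = (2 * sqrt 2 - 1) * (real p + 1) + (2 - 2 * sqrt 2) * ((real p + 3) / 2)"
    unfolding sum_list_addf sum_list_const_mult moments ..
  also have "\<dots> = 2 + sqrt 2 * (real p - 1)" by (simp add: field_simps)
  finally show ?thesis .
qed

section \<open>The second moment of a connected TB graph\<close>

text \<open>The form in which connectedness is used: no proper nonempty vertex set is closed under adjacency.\<close>

lemma connected_cut:
  assumes G: "pair_graph G" and conn: "Digraph_Component.connected (with_proj G)"
    and S: "S \<subset> pverts G" "S \<noteq> {}"
  obtains x y where "(x, y) \<in> parcs G" "x \<in> S" "y \<in> pverts G - S"
proof -
  interpret pair_graph G by fact
  have sc: "strongly_connected (with_proj G)"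
    using symmetric_connected_imp_strongly_connected[OF _ conn] pair_sym_arcs by blast
  obtain a b where ab: "a \<in> S" "b \<in> pverts G" "b \<notin> S" using S by blast
  have "a \<rightarrow>\<^sup>*\<^bsub>with_proj G\<^esub> b"
    using sc ab S(1) by (auto simp: strongly_connected_def)
  then have "b \<in> S \<or> (\<exists>x y. (x, y) \<in> parcs G \<and> x \<in> S \<and> y \<notin> S)"
    by (induction rule: reachable_induct) (use ab in auto)
  with ab obtain x y where "(x, y) \<in> parcs G" "x \<in> S" "y \<notin> S" by blast
  moreover have "y \<in> pverts G" using in_arcsD2[OF calculation(1)] .
  ultimately show ?thesis using that by blast
qed

text \<open>Growing a vertex set from a single vertex along arcs that leave it gains at least one edge, that is,
  two arcs, for every added vertex.\<close>

lemma connected_card_arcs: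
  assumes G: "pair_graph G" and conn: "Digraph_Component.connected (with_proj G)"
    and ne: "pverts G \<noteq> {}"
  shows "2 * card (pverts G) \<le> card (parcs G) + 2"
proof -
  interpret pair_graph G by fact
  have "\<exists>S\<subseteq>pverts G. card S = Suc k \<and> 2 * k \<le> card (parcs G \<inter> S \<times> S)" if "k < card (pverts G)" for k
    using that
  proof (induction k)
    case 0
    obtain a where "a \<in> pverts G" using ne by blast
    then show ?case by (intro exI[of _ "{a}"]) auto
  next
    case (Suc k)
    then obtain S where S: "S \<subseteq> pverts G" "card S = Suc k" "2 * k \<le> card (parcs G \<inter> S \<times> S)" by auto
    have fin: "finite S" using S(2) card.infinite by fastforce
    have "S \<subset> pverts G" "S \<noteq> {}" using S(1,2) Suc.prems by auto
    from connected_cut[OF G conn this] obtain x y where xy: "(x, y) \<in> parcs G" "x \<in> S" "y \<in> pverts G - S" .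
    then have yx: "(y, x) \<in> parcs G" using arcs_symmetric by blast
    have "card (insert (x, y) (insert (y, x) (parcs G \<inter> S \<times> S))) = card (parcs G \<inter> S \<times> S) + 2"
    proof -
      have "finite (parcs G \<inter> S \<times> S)" using fin by simp
      moreover have "(y, x) \<notin> parcs G \<inter> S \<times> S" "(x, y) \<notin> insert (y, x) (parcs G \<inter> S \<times> S)"
        using xy by auto
      ultimately show ?thesis by simp
    qed
    moreover have "card (insert (x, y) (insert (y, x) (parcs G \<inter> S \<times> S)))
        \<le> card (parcs G \<inter> insert y S \<times> insert y S)"
      using xy yx by (intro card_mono) auto
    ultimately have "2 * k + 2 \<le> card (parcs G \<inter> insert y S \<times> insert y S)"
      using S(3) by (metis add_le_mono1 le_trans)
    then have "2 * Suc k \<le> card (parcs G \<inter> insert y S \<times> insert y S)" by simp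
    moreover have "insert y S \<subseteq> pverts G" using S(1) xy(3) by blast
    moreover have "card (insert y S) = Suc (Suc k)" using S(2) xy(3) fin by simp
    ultimately show ?case by blast
  qed
  from this[of "card (pverts G) - 1"] obtain S
    where S: "2 * (card (pverts G) - 1) \<le> card (parcs G \<inter> S \<times> S)"
    using ne by (auto simp: card_gt_0_iff)
  also have "\<dots> \<le> card (parcs G)" by (intro card_mono) auto
  finally show ?thesis by linarith
qed

lemma sum_neighbours:
  fixes h :: "'a \<Rightarrow> 'b :: comm_monoid_add"
  assumes "pair_graph G"
  shows "(\<Sum>v\<in>pverts G. if (u, v) \<in> parcs G then h v else 0) = (\<Sum>v | (u, v) \<in> parcs G. h v)"
proof -
  interpret pair_graph G by fact
  have "pverts G \<inter> {v. (u, v) \<in> parcs G} = {v. (u, v) \<in> parcs G}"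
    using in_arcsD2 by blast
  then show ?thesis by (simp add: sum.If_cases)
qed

lemma sum_arcs:
  fixes h :: "'a \<Rightarrow> 'a \<Rightarrow> 'b :: comm_monoid_add"
  assumes "pair_graph G"
  shows "(\<Sum>(u, v)\<in>parcs G. h u v) = (\<Sum>u\<in>pverts G. \<Sum>v | (u, v) \<in> parcs G. h u v)"
proof -
  interpret pair_graph G by fact
  have "parcs G = (SIGMA u:pverts G. {v. (u, v) \<in> parcs G})"
    by (auto dest: in_arcsD1)
  moreover have "finite {v. (u, v) \<in> parcs G}" for u
    by (rule finite_subset[OF _ pair_finite_verts]) (use in_arcsD2 in blast)
  ultimately show ?thesis by (simp add: sum.Sigma)
qed

text \<open>Every vertex shares a total of 1 equally among its arcs, and reversing all arcs preserves the arc set.\<close>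

lemma sum_arcs_inverse_degree:
  assumes G: "pair_graph G" and pos: "\<And>u. u \<in> pverts G \<Longrightarrow> degree_of G u > 0"
  shows "(\<Sum>(u, v)\<in>parcs G. 1 / real (degree_of G u)) = card (pverts G)"
    and "(\<Sum>(u, v)\<in>parcs G. 1 / real (degree_of G v)) = card (pverts G)"
proof -
  interpret pair_graph G by fact
  show *: "(\<Sum>(u, v)\<in>parcs G. 1 / real (degree_of G u)) = card (pverts G)"
  proof -
    have "(\<Sum>v | (u, v) \<in> parcs G. 1 / real (degree_of G u)) = 1" if "u \<in> pverts G" for u
      using pos[OF that] by (simp add: degree_of_eq)
    then have "(\<Sum>u\<in>pverts G. \<Sum>v | (u, v) \<in> parcs G. 1 / real (degree_of G u)) = (\<Sum>u\<in>pverts G. 1)"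
      by (rule sum.cong[OF refl])
    then show ?thesis unfolding sum_arcs[OF G] by simp
  qed
  have "prod.swap ` parcs G = parcs G"
    using arcs_symmetric by force
  then have "(\<Sum>(u, v)\<in>parcs G. 1 / real (degree_of G v)) = (\<Sum>(u, v)\<in>prod.swap ` parcs G. 1 / real (degree_of G v))"
    by simp
  also have "\<dots> = (\<Sum>(u, v)\<in>parcs G. 1 / real (degree_of G u))"
    by (subst sum.reindex) (auto intro!: sum.cong)
  finally show "(\<Sum>(u, v)\<in>parcs G. 1 / real (degree_of G v)) = card (pverts G)" using * by simp
qed

lemma connected_degree_pos:
  assumes G: "pair_graph G" and conn: "Digraph_Component.connected (with_proj G)"
    and n: "card (pverts G) > 1" and u: "u \<in> pverts G"
  shows "degree_of G u > 0"
proof -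
  interpret pair_graph G by fact
  have "{u} \<noteq> pverts G"
  proof
    assume "{u} = pverts G"
    from arg_cong[OF this, of card] n show False by simp
  qed
  then obtain y where "(u, y) \<in> parcs G"
    using connected_cut[OF G conn, of "{u}"] u by blast
  moreover have "finite {v. (u, v) \<in> parcs G}"
    by (rule finite_subset[OF _ pair_finite_verts]) (use in_arcsD2 in blast)
  ultimately show ?thesis unfolding degree_of_eq by (auto simp: card_gt_0_iff)
qed

text \<open>An edge between two vertices of degree 1 would be a whole component, but there are more vertices.\<close>

lemma connected_arc_not_both_pendant:
  assumes G: "pair_graph G" and conn: "Digraph_Component.connected (with_proj G)"
    and n: "card (pverts G) > 2" and uv: "(u, v) \<in> parcs G"
  shows "degree_of G u \<noteq> 1 \<or> degree_of G v \<noteq> 1"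
proof (rule ccontr)
  interpret pair_graph G by fact
  assume "\<not> ?thesis"
  then have deg: "card {w. (u, w) \<in> parcs G} = 1" "card {w. (v, w) \<in> parcs G} = 1"
    by (simp_all add: degree_of_eq)
  have vu: "(v, u) \<in> parcs G" using uv arcs_symmetric by blast
  obtain a b where ab: "{w. (u, w) \<in> parcs G} = {a}" "{w. (v, w) \<in> parcs G} = {b}"
    using deg by (auto simp only: card_1_singleton_iff One_nat_def)
  moreover have "v = a" "u = b" using ab uv vu by auto
  ultimately have one: "{w. (u, w) \<in> parcs G} = {v}" "{w. (v, w) \<in> parcs G} = {u}"
    by simp_all
  have "{u, v} \<subseteq> pverts G" using in_arcsD1[OF uv] in_arcsD2[OF uv] by auto
  moreover have "{u, v} \<noteq> pverts G"
  proof
    assume "{u, v} = pverts G"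
    moreover have "card {u, v} \<le> 2" by (simp add: card_insert_if)
    ultimately show False using n by simp
  qed
  ultimately show False
    using connected_cut[OF G conn, of "{u, v}"] one by blast
qed

text \<open>No edge has both ends of degree above 2, by the TB property, or both of degree 1, by connectedness.
  So \<open>1/2\<close> lies between the inverse degrees of its ends, that is,
  \<open>(1 / d u - 1/2) (1 / d v - 1/2) \<le> 0\<close>, which bounds a product of inverse degrees by an expression linear in
  each of them. Its sum over all arcs depends only on the numbers of vertices and arcs, and the number
  of arcs is at least \<open>2 (n - 1)\<close>.\<close>

lemma TB_trace_bound:
  assumes TB: "TB_graph G" and conn: "Digraph_Component.connected (with_proj G)"
    and n: "card (pverts G) > 2"
  shows "(\<Sum>u\<in>pverts G. \<Sum>v\<in>pverts G. (randic_entry G u v)\<^sup>2) \<le> (card (pverts G) + 1) / 2"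
proof -
  have G: "pair_graph G" using TB by (simp add: TB_graph_def)
  interpret pair_graph G by fact
  obtain A B where AB: "bipartition G A B" "\<And>b. b \<in> B \<Longrightarrow> degree_of G b \<le> 2"
    using TB by (auto simp: TB_graph_def)
  have pos: "degree_of G u > 0" if "u \<in> pverts G" for u
    using connected_degree_pos[OF G conn _ that] n by simp
  have arc: "1 / (real (degree_of G u) * real (degree_of G v))
      \<le> 1 / (2 * real (degree_of G u)) + 1 / (2 * real (degree_of G v)) - 1 / 4"
    if uv: "(u, v) \<in> parcs G" for u v
  proof -
    define a b where "a = real (degree_of G u)" and "b = real (degree_of G v)"
    have ge: "degree_of G u > 0" "degree_of G v > 0"
      using pos in_arcsD1[OF uv] in_arcsD2[OF uv] by auto
    have "degree_of G u \<le> 2 \<or> degree_of G v \<le> 2"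
      using AB uv by (auto simp: bipartition_def)
    with ge connected_arc_not_both_pendant[OF G conn n uv]
    have "degree_of G u \<ge> 2 \<and> degree_of G v \<le> 2 \<or> degree_of G u \<le> 2 \<and> degree_of G v \<ge> 2"
      by linarith
    then have "(a - 2) * (b - 2) \<le> 0"
      unfolding a_def b_def by (auto simp: mult_le_0_iff)
    moreover have "a > 0" "b > 0" using ge by (simp_all add: a_def b_def)
    ultimately show ?thesis unfolding a_def[symmetric] b_def[symmetric] by (simp add: field_simps)
  qed
  have "(\<Sum>u\<in>pverts G. \<Sum>v\<in>pverts G. (randic_entry G u v)\<^sup>2) =
      (\<Sum>u\<in>pverts G. \<Sum>v\<in>pverts G. if (u, v) \<in> parcs G
         then 1 / (real (degree_of G u) * real (degree_of G v)) else 0)"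
    by (intro sum.cong refl) (simp add: randic_entry_def power_divide)
  also have "\<dots> = (\<Sum>(u, v)\<in>parcs G. 1 / (real (degree_of G u) * real (degree_of G v)))"
    unfolding sum_neighbours[OF G] sum_arcs[OF G] ..
  also have "\<dots> \<le> (\<Sum>(u, v)\<in>parcs G.
      1 / (2 * real (degree_of G u)) + 1 / (2 * real (degree_of G v)) - 1 / 4)"
    by (intro sum_mono) (auto intro: arc)
  also have "\<dots> = (\<Sum>(u, v)\<in>parcs G. 1 / real (degree_of G u)) / 2
      + (\<Sum>(u, v)\<in>parcs G. 1 / real (degree_of G v)) / 2 - card (parcs G) / 4"
    by (simp add: case_prod_beta sum.distrib sum_subtractf sum_divide_distrib mult.commute)
  also have "\<dots> = card (pverts G) - card (parcs G) / 4"
    by (simp add: sum_arcs_inverse_degree[OF G pos])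
  also have "\<dots> \<le> (card (pverts G) + 1) / 2"
  proof -
    have "pverts G \<noteq> {}" using n by auto
    from connected_card_arcs[OF G conn this] show ?thesis by simp
  qed
  finally show ?thesis .
qed

section \<open>The three forced eigenvalues\<close>

text \<open>For constant \<open>c\<close> and \<open>k = 1\<close> this says that the square roots of the degrees form an eigenvector
  for 1. Letting \<open>c\<close> change sign along every edge gives \<open>k = -1\<close> for a bipartite graph.\<close>

lemma randic_sqrt_degree:
  assumes G: "pair_graph G" and pos: "degree_of G u > 0"
    and c: "\<And>v. (u, v) \<in> parcs G \<Longrightarrow> degree_of G v > 0 \<and> c v = k * c u"
  shows "(\<Sum>v\<in>pverts G. randic_entry G u v * (c v * sqrt (degree_of G v))) = k * (c u * sqrt (degree_of G u))"
proof -
  let ?d = "\<lambda>v. real (degree_of G v)"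
  have "(\<Sum>v\<in>pverts G. randic_entry G u v * (c v * sqrt (?d v))) =
      (\<Sum>v\<in>pverts G. if (u, v) \<in> parcs G then k * c u / sqrt (?d u) else 0)"
    using c by (intro sum.cong refl) (auto simp: randic_entry_def real_sqrt_mult)
  also have "\<dots> = ?d u * (k * c u / sqrt (?d u))"
    unfolding sum_neighbours[OF G] by (simp add: degree_of_eq)
  also have "\<dots> = k * (c u * sqrt (?d u))"
    using pos by (simp add: field_simps)
  finally show ?thesis .
qed

text \<open>Changing the sign of the coordinates in \<open>A\<close> conjugates \<open>R\<close> into \<open>-R\<close>, so
  \<open>det R = det (-R) = - det R\<close> in odd dimension.\<close>

lemma bipartite_odd_kernel:
  assumes G: "pair_graph G" and AB: "bipartition G A B" and odd: "odd (card (pverts G))"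
  shows "\<exists>f. (\<exists>v\<in>pverts G. f v \<noteq> 0) \<and>
    (\<forall>u\<in>pverts G. (\<Sum>v\<in>pverts G. randic_entry G u v * f v) = 0 * f u)"
proof -
  interpret pair_graph G by fact
  let ?r = "randic_entry G"
  obtain vs where vs: "distinct vs" "set vs = pverts G"
    using finite_distinct_list[OF pair_finite_verts] by blast
  define n where "n = length vs"
  have n: "odd n" using odd vs distinct_card unfolding n_def by metis
  define \<sigma> :: "'a \<Rightarrow> real" where "\<sigma> v = (if v \<in> A then 1 else -1)" for v
  define S where "S = indexed_mat vs (\<lambda>u v. if u = v then \<sigma> u else 0)"
  define R where "R = indexed_mat vs ?r"
  have carr: "S \<in> carrier_mat n n" "R \<in> carrier_mat n n" by (simp_all add: S_def R_def n_def)
  have flip: "\<sigma> u * ?r u v * \<sigma> v = - ?r u v" for u v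
    using AB by (auto simp: \<sigma>_def randic_entry_def bipartition_def)
  have "S * R * S = (-1) \<cdot>\<^sub>m R"
  proof -
    have "S * R * S = indexed_mat vs (\<lambda>u w. \<Sum>v\<in>set vs. (\<Sum>x\<in>set vs. (if u = x then \<sigma> u else 0) * ?r x v)
        * (if v = w then \<sigma> v else 0))"
      unfolding S_def R_def indexed_mat_mult[OF vs(1)] ..
    also have "\<dots> = (-1) \<cdot>\<^sub>m R"
      by (rule eq_matI) (simp_all add: indexed_mat_def R_def if_zero_arith flip cong: if_cong)
    finally show ?thesis .
  qed
  moreover have "S * S = 1\<^sub>m n"
    unfolding S_def indexed_mat_mult[OF vs(1)] n_def
    by (rule eq_matI) (use vs(1) in \<open>auto simp: indexed_mat_def if_zero_arith \<sigma>_def nth_eq_iff_index_eq cong: if_cong\<close>)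
  ultimately have "det S * det R * det S = - det R" "det S * det S = 1"
    using carr n det_mult[of S n R] det_mult[of "S * R" n S] det_mult[of S n S] det_smult[of "-1" R]
    by (auto simp: n_def)
  then have "det R = 0" by (simp add: algebra_simps)
  then have "eigenvalue R 0"
  proof -
    have "char_matrix R 0 = R" using carr(2) by (intro eq_matI) (auto simp: char_matrix_def)
    with \<open>det R = 0\<close> show ?thesis by (simp add: eigenvalue_det[OF carr(2)])
  qed
  then show ?thesis unfolding R_def eigenvalue_indexed_mat_iff[OF vs(1)] vs(2) .
qed

section \<open>The extremal inequality\<close>

text \<open>Of the even quadratic functions touching the absolute value from above, this one touches it at
  \<open>1 / sqrt 2\<close> and \<open>-1 / sqrt 2\<close>, the values of all eigenvalues of the sun other than 0, 1 and -1.\<close>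

lemma abs_le_quadratic: "\<bar>x\<bar> \<le> sqrt 2 / 2 * x\<^sup>2 + sqrt 2 / 4" for x :: real
proof -
  \<comment> \<open>A square that vanishes exactly at the two points of tangency.\<close>
  have "0 \<le> (sqrt 2 * \<bar>x\<bar> - 1)\<^sup>2" by simp
  also have "\<dots> = 2 * x\<^sup>2 - 2 * sqrt 2 * \<bar>x\<bar> + 1"
    by (simp add: power2_diff power_mult_distrib)
  finally have "sqrt 2 * (2 * sqrt 2 * \<bar>x\<bar>) \<le> sqrt 2 * (2 * x\<^sup>2 + 1)"
    by (intro mult_left_mono) simp_all
  then show ?thesis by (simp add: field_simps)
qed

text \<open>The three prescribed values are set aside before the tangent inequality is applied to the others,
  because it is strict at 0, 1 and -1.\<close>

lemma sum_abs_le_of_sum_squares: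
  assumes ex: "{0, 1, -1} \<subseteq> set es" and len: "length es = 2 * p + 1"
    and sq: "(\<Sum>e\<leftarrow>es. e ^ 2) \<le> real p + 1"
  shows "(\<Sum>e\<leftarrow>es. \<bar>e\<bar>) \<le> 2 + sqrt 2 * (real p - 1)"
proof -
  have "{#0, 1, -1#} \<subseteq># mset es"
    using ex by (subst insert_subset_eq_iff) (auto simp: insert_subset_eq_iff in_diff_count)
  then obtain M where M: "mset es = {#0, 1, -1#} + M" using subset_mset.less_eqE by blast
  have tr: "(\<Sum>e\<leftarrow>es. h e) = h 0 + h 1 + h (-1) + (\<Sum>e\<in>#M. h e)" for h :: "real \<Rightarrow> real"
    using arg_cong[OF M, of "\<lambda>N. \<Sum>e\<in>#N. h e"] by (simp add: sum_mset_sum_list add.assoc flip: mset_map)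
  have "size M = 2 * p - 2" "p \<ge> 1" using arg_cong[OF M, of size] len by auto
  then have size: "real (size M) = 2 * real p - 2" by simp
  have sqM: "(\<Sum>e\<in>#M. e ^ 2) \<le> real p - 1" using sq unfolding tr by simp
  have "(\<Sum>e\<in>#M. \<bar>e\<bar>) \<le> (\<Sum>e\<in>#M. sqrt 2 / 2 * e ^ 2 + sqrt 2 / 4)"
    by (intro sum_mset_mono abs_le_quadratic)
  also have "\<dots> = sqrt 2 / 2 * (\<Sum>e\<in>#M. e ^ 2) + sqrt 2 / 4 * size M"
    by (induction M) (simp_all add: algebra_simps)
  also have "\<dots> \<le> sqrt 2 / 2 * (real p - 1) + sqrt 2 / 4 * (2 * real p - 2)"
    using sqM unfolding size by (intro add_right_mono mult_left_mono) auto
  also have "\<dots> = sqrt 2 * (real p - 1)" by (simp add: field_simps)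
  finally show ?thesis unfolding tr by simp
qed

theorem mainTheorem5:
  fixes G :: "'a pair_pre_digraph" and p :: nat
  assumes "TB_graph G"
    and "Digraph_Component.connected (with_proj G)"
    and "card (pverts G) = 2 * p + 1"
    and "p \<ge> 1"
  shows "randic_energy G \<le> randic_energy (sun p)"
proof -
  have G: "pair_graph G" using assms(1) by (simp add: TB_graph_def)
  interpret pair_graph G by fact
  obtain A B where AB: "bipartition G A B" using assms(1) by (auto simp: TB_graph_def)
  obtain es :: "real list" where es:
    "randic_energy G = (\<Sum>e\<leftarrow>es. \<bar>e\<bar>)" "length es = card (pverts G)"
    "\<And>x. x \<in> set es \<longleftrightarrow> (\<exists>f. (\<exists>v\<in>pverts G. f v \<noteq> 0) \<and>
        (\<forall>u\<in>pverts G. (\<Sum>v\<in>pverts G. randic_entry G u v * f v) = x * f u))"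
    "(\<Sum>e\<leftarrow>es. e ^ 2) = (\<Sum>u\<in>pverts G. \<Sum>v\<in>pverts G. (randic_entry G u v)\<^sup>2)"
    by (rule randic_spectrum[OF G]) (rule that; simp)
  have pos: "degree_of G u > 0" if "u \<in> pverts G" for u
    using connected_degree_pos[OF G assms(2) _ that] assms(3,4) by simp
  obtain z where z: "z \<in> pverts G" using assms(3) by fastforce
  have signed: "k \<in> set es"
    if c: "c z \<noteq> 0" "\<And>u v. (u, v) \<in> parcs G \<Longrightarrow> c v = k * c u" for c and k :: real
    unfolding es(3) using randic_sqrt_degree[OF G pos, of _ c k] pos c z in_arcsD2
    by (intro exI[of _ "\<lambda>v. c v * sqrt (degree_of G v)"]) auto
  have "1 \<in> set es" by (rule signed[of "\<lambda>_. 1"]) auto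
  moreover have "-1 \<in> set es"
    by (rule signed[of "\<lambda>v. if v \<in> A then 1 else -1"]) (use AB in \<open>auto simp: bipartition_def\<close>)
  moreover have "0 \<in> set es"
    unfolding es(3) using bipartite_odd_kernel[OF G AB] assms(3) by simp
  ultimately have "{0, 1, -1} \<subseteq> set es" by simp
  moreover have "(\<Sum>e\<leftarrow>es. e ^ 2) \<le> real p + 1"
    using TB_trace_bound[OF assms(1,2)] assms(3,4) unfolding es(4) by simp
  ultimately show ?thesis
    unfolding randic_energy_sun[OF assms(4)] es(1) by (intro sum_abs_le_of_sum_squares) (simp_all add: es(2) assms(3))
qed

end
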